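(* The total number of iterations of the inner while loop of Algorithm A (described in the context), summed over all phases, is $O\!\left(\log(n)\log(1/\epsilon)/\epsilon^3\right)$.
   Context: Let $f:[0,1]^n\to\mathbb{R}_+$ be a non-negative differentiable DR-submodular function (i.e. $\nabla f(\vec{x})\ge\nabla f(\vec{y})$ coordinate-wise whenever $\vec{x}\le\vec{y}$), extended to $\mathbb{R}^n_+$ by $f(\vec{x})=f(\vec{x}\wedge\vec{1})$ where $(\vec{x}\wedge\vec{1})_i=\min\{x_i,1\}$. Let $k>0$, let $\epsilon\in(0,1)$ with $1/\epsilon$ an integer, let $\vec{x}^*$ be an optimal solution of $\max\{f(\vec{x}):\vec{x}\in[0,1]^n,\|\vec{x}\|_1\le k\}$, and let $M$ satisfy $f(\vec{x}^* )\le M\le(1+\epsilon)f(\vec{x}^* )$. Notation: $\vec{0},\vec{1}$ are the all-zeros/all-ones vectors, $\vec{1}_S$ is the indicator vector of $S\subseteq[n]$, $\circ$ is the coordinate-wise product, $\le$ between vectors is coordinate-wise. Algorithm A: set $\vec{x}\gets\vec{0}$, $\vec{z}\gets\vec{0}$. For $j=1,\dots,1/\epsilon$ (phase $j$): set $\vec{x}_{\mathrm{start}}\gets\vec{x}$, $\vec{z}_{\mathrm{start}}\gets\vec{z}$, $v_{\mathrm{start}}\gets\frac1k\big(((1-\epsilon)^j-2\epsilon)M-f(\vec{x})\big)$, $v\gets v_{\mathrm{start}}$. While $v>\epsilon v_{\mathrm{start}}$ and $\|\vec{z}\|_1<\epsilon jk$ (one iteration): let $\vec{g}=(\vec{1}-\vec{z})\circ\nabla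 f(\vec{z})$ and $S=\{i\in[n]: \vec{g}_i\ge v,\ \vec{z}_i\le 1-(1-\epsilon)^j,\ \vec{z}_i-(\vec{z}_{\mathrm{start}})_i<\epsilon(1-(\vec{z}_{\mathrm{start}})_i)\}$. If $S=\emptyset$, set $v\gets(1-\epsilon)v$. Otherwise, for $\eta\in[0,\epsilon^2]$ define $\vec{z}(\eta)=\vec{z}+\eta(\vec{1}-\vec{z})\circ\vec{1}_S$, $\vec{g}(\eta)=(\vec{1}-\vec{z}(\eta))\circ\nabla f(\vec{z}(\eta))$, $S(\eta)=\{i\in S:\vec{g}(\eta)_i\ge v\}$, $T(\eta)=\{i\in S:\vec{g}(\eta)_i>0\}$; let $\eta_1$ be the maximum $\eta\in[0,\epsilon^2]$ with $|S(\eta)|\ge(1-\epsilon)|S|$ (computed exactly), let $\eta_2$ be the maximum $\eta\in[0,\epsilon^2]$ with $\|\vec{z}(\eta)\|_1\le\epsilon jk$, and $\eta\gets\min\{\eta_1,\eta_2\}$; then update $\vec{x}\gets\vec{x}+\eta(\vec{1}-\vec{x})\circ\vec{1}_{T(\eta)}$ and $\vec{z}\gets\vec{z}+\eta(\vec{1}-\vec{z})\circ\vec{1}_S$, and if $f(\vec{z})>f(\vec{x})$ set $\vec{x}\gets\vec{z}$. After all phases return $\vec{x}$.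
   Formalization: As stated the loop can run forever: after a step to a point with g_i = v, S is unchanged and η = 0. The bound is proved for runs that have not reached a state where the loop condition holds but an iteration changes nothing, and for n ≥ 2, since log 1 = 0. *)

theory Defs
  imports "HOL-Analysis.Analysis"
begin

text \<open>
  Vectors in \<open>\<real>\<^sup>n\<close> are functions \<open>nat \<Rightarrow> real\<close> vanishing outside \<open>{..<n}\<close>, rather than elements of a
  type indexed by the dimension: the constant hidden in an \<open>O\<close>-bound must not depend on \<open>n\<close>, so \<open>n\<close>
  has to be quantified inside the statement.
\<close>

type_synonym vector = "nat \<Rightarrow> real"

definition orthant :: "nat \<Rightarrow> vector set" where
  "orthant n = {x. (\<forall>i<n. 0 \<le> x i) \<and> (\<forall>i\<ge>n. x i = 0)}"

definition cube :: "nat \<Rightarrow> vector set" where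
  "cube n = {x \<in> orthant n. \<forall>i<n. x i \<le> 1}"

definition norm1 :: "nat \<Rightarrow> vector \<Rightarrow> real" where
  "norm1 n x = (\<Sum>i<n. \<bar>x i\<bar>)"

definition feasible :: "nat \<Rightarrow> real \<Rightarrow> vector set" where
  "feasible n k = {x \<in> cube n. norm1 n x \<le> k}"

definition cap :: "vector \<Rightarrow> vector" where
  "cap x = (\<lambda>i. min (x i) 1)"

text \<open>
  Frechet differentiability of \<open>f\<close> at \<open>x\<close> relative to the cube, with gradient \<open>g\<close>: this is
  the characterization \<open>has_derivative_within_alt\<close> for the derivative \<open>h \<mapsto> \<Sum>i<n. g i * h i\<close>. On the boundary of the
  cube the derivative is one-sided; \<open>g\<close> is determined on \<open>{..<n}\<close>, since the cube has nonempty interior.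
\<close>

definition has_gradient :: "nat \<Rightarrow> (vector \<Rightarrow> real) \<Rightarrow> vector \<Rightarrow> vector \<Rightarrow> bool" where
  "has_gradient n f x g \<longleftrightarrow>
     (\<forall>e>0. \<exists>d>0. \<forall>y\<in>cube n. L2_set (\<lambda>i. y i - x i) {..<n} < d \<longrightarrow>
        \<bar>f y - f x - (\<Sum>i<n. g i * (y i - x i))\<bar> \<le> e * L2_set (\<lambda>i. y i - x i) {..<n})"

definition differentiable_DR_submodular ::
    "nat \<Rightarrow> (vector \<Rightarrow> real) \<Rightarrow> (vector \<Rightarrow> vector) \<Rightarrow> bool" where
  "differentiable_DR_submodular n f G \<longleftrightarrow>
     (\<forall>x\<in>cube n. has_gradient n f x (G x)) \<and>
     (\<forall>x\<in>cube n. \<forall>y\<in>cube n. (\<forall>i<n. x i \<le> y i) \<longrightarrow> (\<forall>i<n. G x i \<ge> G y i))"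

text \<open>
  The state of the algorithm at the head of the inner loop. The vector \<open>x\<^sub>s\<^sub>t\<^sub>a\<^sub>r\<^sub>t\<close> is never read by the
  algorithm and is therefore not recorded.
\<close>

record config =
  phase :: nat
  xvec :: vector
  zvec :: vector
  zstart :: vector
  vstart :: real
  vcur :: real

definition enter_phase ::
    "(vector \<Rightarrow> real) \<Rightarrow> real \<Rightarrow> real \<Rightarrow> real \<Rightarrow> nat \<Rightarrow> vector \<Rightarrow> vector \<Rightarrow> config" where
  "enter_phase f k \<epsilon> M j x z =
     (let v = (((1 - \<epsilon>) ^ j - 2 * \<epsilon>) * M - f x) / k
      in \<lparr>phase = j, xvec = x, zvec = z, zstart = z, vstart = v, vcur = v\<rparr>)"

definition loop_cond :: "nat \<Rightarrow> real \<Rightarrow> real \<Rightarrow> config \<Rightarrow> bool" where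
  "loop_cond n k \<epsilon> c \<longleftrightarrow>
     vcur c > \<epsilon> * vstart c \<and> norm1 n (zvec c) < \<epsilon> * real (phase c) * k"

definition scaled_gradient :: "(vector \<Rightarrow> vector) \<Rightarrow> vector \<Rightarrow> vector" where
  "scaled_gradient G z = (\<lambda>i. (1 - z i) * G z i)"

text \<open>\<open>y + \<eta> (1 - y) \<circ> 1\<^sub>S\<close>\<close>

definition move :: "vector \<Rightarrow> nat set \<Rightarrow> real \<Rightarrow> vector" where
  "move y S \<eta> = (\<lambda>i. if i \<in> S then y i + \<eta> * (1 - y i) else y i)"

definition active :: "nat \<Rightarrow> (vector \<Rightarrow> vector) \<Rightarrow> real \<Rightarrow> config \<Rightarrow> nat set" where
  "active n G \<epsilon> c =
     {i \<in> {..<n}. scaled_gradient G (zvec c) i \<ge> vcur c \<and>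
        zvec c i \<le> 1 - (1 - \<epsilon>) ^ phase c \<and>
        zvec c i - zstart c i < \<epsilon> * (1 - zstart c i)}"

definition S_eta :: "(vector \<Rightarrow> vector) \<Rightarrow> config \<Rightarrow> nat set \<Rightarrow> real \<Rightarrow> nat set" where
  "S_eta G c S \<eta> = {i \<in> S. scaled_gradient G (move (zvec c) S \<eta>) i \<ge> vcur c}"

definition T_eta :: "(vector \<Rightarrow> vector) \<Rightarrow> config \<Rightarrow> nat set \<Rightarrow> real \<Rightarrow> nat set" where
  "T_eta G c S \<eta> = {i \<in> S. scaled_gradient G (move (zvec c) S \<eta>) i > 0}"

definition eta1 :: "(vector \<Rightarrow> vector) \<Rightarrow> real \<Rightarrow> config \<Rightarrow> nat set \<Rightarrow> real" where
  "eta1 G \<epsilon> c S =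
     (GREATEST \<eta>. \<eta> \<in> {0..\<epsilon>\<^sup>2} \<and> real (card (S_eta G c S \<eta>)) \<ge> (1 - \<epsilon>) * real (card S))"

definition eta2 :: "nat \<Rightarrow> real \<Rightarrow> real \<Rightarrow> config \<Rightarrow> nat set \<Rightarrow> real" where
  "eta2 n k \<epsilon> c S =
     (GREATEST \<eta>. \<eta> \<in> {0..\<epsilon>\<^sup>2} \<and> norm1 n (move (zvec c) S \<eta>) \<le> \<epsilon> * real (phase c) * k)"

definition iteration ::
    "nat \<Rightarrow> (vector \<Rightarrow> real) \<Rightarrow> (vector \<Rightarrow> vector) \<Rightarrow> real \<Rightarrow> real \<Rightarrow> config \<Rightarrow> config" where
  "iteration n f G k \<epsilon> c =
     (let S = active n G \<epsilon> c in
      if S = {} then c\<lparr>vcur := (1 - \<epsilon>) * vcur c\<rparr>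
      else
        let \<eta> = min (eta1 G \<epsilon> c S) (eta2 n k \<epsilon> c S);
            x = move (xvec c) (T_eta G c S \<eta>) \<eta>;
            z = move (zvec c) S \<eta>
        in c\<lparr>xvec := (if f z > f x then z else x), zvec := z\<rparr>)"

text \<open>
  \<open>reaches n f G k \<epsilon> M N c\<close>: the (deterministic) execution arrives at state \<open>c\<close> after exactly \<open>N\<close>
  iterations of the inner loop, summed over all phases so far. Opening a new phase is not an iteration.
\<close>

inductive reaches ::
    "nat \<Rightarrow> (vector \<Rightarrow> real) \<Rightarrow> (vector \<Rightarrow> vector) \<Rightarrow> real \<Rightarrow> real \<Rightarrow> real \<Rightarrow> nat \<Rightarrow> config \<Rightarrow> bool"
  for n f G k \<epsilon> M where
  start: "reaches n f G k \<epsilon> M 0 (enter_phase f k \<epsilon> M 1 (\<lambda>_. 0) (\<lambda>_. 0))"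
| iterate: "reaches n f G k \<epsilon> M N c \<Longrightarrow> loop_cond n k \<epsilon> c \<Longrightarrow>
    reaches n f G k \<epsilon> M (Suc N) (iteration n f G k \<epsilon> c)"
| next_phase: "reaches n f G k \<epsilon> M N c \<Longrightarrow> \<not> loop_cond n k \<epsilon> c \<Longrightarrow> real (phase c) < 1 / \<epsilon> \<Longrightarrow>
    reaches n f G k \<epsilon> M N (enter_phase f k \<epsilon> M (Suc (phase c)) (xvec c) (zvec c))"

text \<open>
  In exact arithmetic the inner loop can get stuck. If \<open>\<eta>\<^sub>1\<close> is attained where \<open>g\<^sub>i = v\<close> for more than a
  fraction \<open>\<epsilon>\<close> of the next set \<open>S\<close>, then the next iteration has step size \<open>0\<close>, changes nothing, and is
  repeated forever. This happens already for two coordinates with equal marginals. No bound holds for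
  these repetitions, so they have to be excluded; a stalled state is a fixed point of the loop body.
\<close>

definition stalled ::
    "nat \<Rightarrow> (vector \<Rightarrow> real) \<Rightarrow> (vector \<Rightarrow> vector) \<Rightarrow> real \<Rightarrow> real \<Rightarrow> config \<Rightarrow> bool" where
  "stalled n f G k \<epsilon> c \<longleftrightarrow> loop_cond n k \<epsilon> c \<and> iteration n f G k \<epsilon> c = c"

end

theory Submission
  imports Defs
begin

text \<open>
  Fix a phase and a threshold \<open>v\<close>. As \<open>z\<close> grows, every positive scaled marginal \<open>g\<^sub>i\<close>
  decreases, strictly so for a coordinate that moves; so the set \<open>S\<close> shrinks from one iteration
  to the next. A step of size \<open>\<epsilon>\<^sup>2\<close> brings all \<open>1 - z\<^sub>i\<close>, \<open>i \<in> S\<close>, down by a factor \<open>1 - \<epsilon>\<^sup>2\<close>, which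
  can happen only \<open>O(1/\<epsilon>)\<close> times before the phase's allowance \<open>\<epsilon> (1 - z\<^sub>s\<^sub>t\<^sub>a\<^sub>r\<^sub>t)\<close> is used up, and a
  step of size \<open>\<eta>\<^sub>2 < \<epsilon>\<^sup>2\<close> ends the phase. For a step of size \<open>\<eta>\<^sub>1\<close> the size of \<open>S\<close> itself need not
  drop by a factor \<open>1 - \<epsilon>\<close>, because of coordinates with \<open>g\<^sub>i = v\<close>. With \<open>S\<^sup>+ = {i \<in> S. g\<^sub>i > v}\<close>, however,
  the next sets satisfy \<open>S' \<subseteq> S\<^sup>+\<close> and \<open>|S'\<^sup>+| < (1 - \<epsilon>) |S|\<close>, so the product \<open>|S| |S\<^sup>+| \<le> n\<^sup>2\<close> drops by
  this factor, which can happen only \<open>O(log n / \<epsilon>)\<close> times. There are \<open>O(log (1/\<epsilon>) / \<epsilon>)\<close> thresholds in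
  each of \<open>1/\<epsilon>\<close> phases.
\<close>

section \<open>Real analysis: antitone derivatives, attained maxima, geometric decay\<close>

text \<open>
  By the mean value theorem an antitone derivative \<open>H\<close> has no jumps, and a jump of an antitone summand
  \<open>h\<close> would be a jump of \<open>H\<close>. This gives the continuity of the single partial derivatives along a
  monotone segment, without which \<open>\<eta>\<^sub>1\<close> need not exist.
\<close>

lemma antitone_summand_of_derivative_continuous:
  fixes \<phi> H h :: "real \<Rightarrow> real"
  assumes deriv: "\<And>t. t \<in> {a..b} \<Longrightarrow> (\<phi> has_real_derivative H t) (at t within {a..b})"
    and h: "\<And>s t. a \<le> s \<Longrightarrow> s \<le> t \<Longrightarrow> t \<le> b \<Longrightarrow> h t \<le> h s"
    and rest: "\<And>s t. a \<le> s \<Longrightarrow> s \<le> t \<Longrightarrow> t \<le> b \<Longrightarrow> H t - h t \<le> H s - h s"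
  shows "continuous_on {a..b} h"
  unfolding continuous_on_iff
proof (intro ballI allI impI)
  fix t e :: real
  assume t: "t \<in> {a..b}" and e: "e > 0"
  obtain d where d: "d > 0"
    and lin: "\<And>y. y \<in> {a..b} \<Longrightarrow> \<bar>y - t\<bar> < d \<Longrightarrow> \<bar>\<phi> y - \<phi> t - H t * (y - t)\<bar> \<le> e / 2 * \<bar>y - t\<bar>"
    using deriv[OF t] e unfolding has_field_derivative_def has_derivative_within_alt
    by (metis half_gt_zero real_norm_def)
  have mvt: "\<exists>\<xi>\<in>{u<..<w}. \<phi> w - \<phi> u = H \<xi> * (w - u)" if "a \<le> u" "u < w" "w \<le> b" for u w
  proof -
    have "\<exists>\<xi>\<in>{u<..<w}. \<phi> w - \<phi> u = (*) (H \<xi>) (w - u)"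
    proof (rule mvt_simple)
      fix x assume "u \<le> x" "x \<le> w"
      with that have "x \<in> {a..b}" "{u..w} \<subseteq> {a..b}" by auto
      then show "(\<phi> has_derivative (*) (H x)) (at x within {u..w})"
        using deriv has_derivative_subset unfolding has_field_derivative_def by blast
    qed (use that in auto)
    then show ?thesis .
  qed
  \<comment> \<open>Just to the right of \<open>t\<close> the difference quotient of
    \<open>\<phi>\<close> is both close to \<open>H t\<close> and equal to some
    \<open>H \<xi>\<close>. From \<open>t\<close> to \<open>\<xi>\<close> the function
    \<open>h\<close> drops at most as much as \<open>H\<close>, because \<open>H - h\<close> is
    antitone. For \<open>t = b\<close> any \<open>r > t\<close> serves.\<close>
  have right: "\<exists>r>t. t < b \<longrightarrow> r \<le> b \<and> h t - h r < e"
  proof (cases "t < b")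
    case True
    define s where "s = min b (t + d / 2)"
    have s: "t < s" "s \<le> b" "\<bar>s - t\<bar> < d" "s \<in> {a..b}"
      using True d t by (auto simp: s_def min_def)
    obtain \<xi> where x: "\<xi> \<in> {t<..<s}" "\<phi> s - \<phi> t = H \<xi> * (s - t)"
      using mvt[of t s] s t by auto
    have "\<bar>(H \<xi> - H t) * (s - t)\<bar> \<le> e / 2 * \<bar>s - t\<bar>"
      using lin[OF s(4,3)] x(2) by (simp add: algebra_simps)
    then have "\<bar>H \<xi> - H t\<bar> \<le> e / 2" using s by (simp add: abs_mult)
    then have "H t - H \<xi> < e" using e by linarith
    moreover have "h t - h \<xi> \<le> H t - H \<xi>" using rest[of t \<xi>] x s t by auto
    ultimately show ?thesis using x s e by (intro exI[of _ \<xi>]) auto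
  qed (auto intro: gt_ex)
  have left: "\<exists>r<t. a < t \<longrightarrow> a \<le> r \<and> h r - h t < e"
  proof (cases "a < t")
    case True
    define s where "s = max a (t - d / 2)"
    have s: "s < t" "a \<le> s" "\<bar>s - t\<bar> < d" "s \<in> {a..b}"
      using True d t by (auto simp: s_def max_def)
    obtain \<xi> where x: "\<xi> \<in> {s<..<t}" "\<phi> t - \<phi> s = H \<xi> * (t - s)"
      using mvt[of s t] s t by auto
    have "\<phi> s - \<phi> t - H t * (s - t) = (H \<xi> - H t) * (s - t)" using x(2) by (simp add: algebra_simps)
    then have "\<bar>(H \<xi> - H t) * (s - t)\<bar> \<le> e / 2 * \<bar>s - t\<bar>"
      using lin[OF s(4,3)] by simp
    then have "\<bar>H \<xi> - H t\<bar> \<le> e / 2" using s by (simp add: abs_mult)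
    then have "H \<xi> - H t < e" using e by linarith
    moreover have "h \<xi> - h t \<le> H \<xi> - H t" using rest[of \<xi> t] x s t by auto
    ultimately show ?thesis using x s e by (intro exI[of _ \<xi>]) auto
  qed (auto intro: lt_ex)
  obtain r where r: "r > t" "t < b \<Longrightarrow> r \<le> b \<and> h t - h r < e" using right by auto
  obtain l where l: "l < t" "a < t \<Longrightarrow> a \<le> l \<and> h l - h t < e" using left by auto
  \<comment> \<open>Antitonicity squeezes \<open>h\<close> between its values at \<open>l\<close>
    and \<open>r\<close>, so the two witnesses control a whole neighbourhood.\<close>
  show "\<exists>d>0. \<forall>y\<in>{a..b}. dist y t < d \<longrightarrow> dist (h y) (h t) < e"
  proof (intro exI[of _ "min (r - t) (t - l)"] conjI ballI impI)
    fix y assume y: "y \<in> {a..b}" "dist y t < min (r - t) (t - l)"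
    consider "y = t" | "y > t" | "y < t" by linarith
    then show "dist (h y) (h t) < e"
    proof cases
      case 2
      then have "r \<le> b" "h t - h r < e" using r y by auto
      then show ?thesis
        using h[of t y] h[of y r] 2 y t by (auto simp: dist_real_def)
    next
      case 3
      then have "a \<le> l" "h l - h t < e" using l y t by auto
      then show ?thesis
        using h[of y t] h[of l y] 3 y t by (auto simp: dist_real_def)
    qed (use e in simp)
  qed (use r l in auto)
qed

text \<open>\<open>GREATEST\<close> carries information only if the maximum is attained; compactness
  ensures this for both step sizes.\<close>

lemma Greatest_compact:
  fixes P :: "real \<Rightarrow> bool"
  assumes "compact {x. P x}" "P x0"
  shows "P (GREATEST x. P x)" "\<And>y. P y \<Longrightarrow> y \<le> (GREATEST x. P x)"
proof -
  obtain m where m: "P m" "\<And>y. P y \<Longrightarrow> y \<le> m"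
    using compact_attains_sup[OF assms(1)] assms(2) by blast
  then have "(GREATEST x. P x) = m" by (intro Greatest_equality)
  then show "P (GREATEST x. P x)" "\<And>y. P y \<Longrightarrow> y \<le> (GREATEST x. P x)" using m by auto
qed

text \<open>From \<open>1 - x \<le> exp (- x)\<close>. It turns each kind of geometric decay into a
  count: of reductions of \<open>v\<close>, of full steps, and of drops of
  \<open>|S| |S\<^sup>+|\<close>.\<close>

lemma geometric_exponent_bound:
  fixes x y :: real
  assumes "0 < y" "x < 1" "y \<le> (1 - x) ^ m"
  shows "real m * x \<le> ln (1 / y)"
proof -
  have "(1 - x) ^ m \<le> exp (- x) ^ m"
    using assms(2) exp_ge_add_one_self[of "- x"] by (intro power_mono) auto
  also have "\<dots> = exp (- (real m * x))" by (simp flip: exp_of_nat_mult)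
  finally have "y \<le> exp (- (real m * x))" using assms(3) by linarith
  then have "ln y \<le> - (real m * x)" using assms(1) by (metis exp_le_cancel_iff exp_ln)
  then show ?thesis using assms(1) by (simp add: ln_div)
qed

section \<open>The segment \<open>move z S t\<close> inside the cube\<close>

lemma one_minus_move: "i \<in> S \<Longrightarrow> 1 - move z S t i = (1 - t) * (1 - z i)"
  by (simp add: move_def algebra_simps)

lemma move_zero [simp]: "move z S 0 = z"
  by (auto simp: move_def)

lemma move_in_cube:
  assumes "z \<in> cube n" "S \<subseteq> {..<n}" "0 \<le> t" "t \<le> 1"
  shows "move z S t \<in> cube n"
proof -
  have "0 \<le> z i + t * (1 - z i) \<and> z i + t * (1 - z i) \<le> 1" if "i < n" for i
  proof
    have z: "0 \<le> z i" "z i \<le> 1" using assms(1) that by (auto simp: cube_def orthant_def)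
    then show "0 \<le> z i + t * (1 - z i)" using assms by simp
    have "t * (1 - z i) \<le> 1 * (1 - z i)" using assms z by (intro mult_right_mono) auto
    then show "z i + t * (1 - z i) \<le> 1" by simp
  qed
  then show ?thesis using assms by (auto simp: cube_def orthant_def move_def)
qed

lemma move_mono:
  assumes "z \<in> cube n" "S \<subseteq> {..<n}" "s \<le> t"
  shows "move z S s i \<le> move z S t i"
proof (cases "i \<in> S")
  case True
  then have "z i \<le> 1" using assms by (auto simp: cube_def)
  then show ?thesis using assms by (simp add: move_def mult_right_mono)
qed (simp add: move_def)

text \<open>Chain rule along the segment in direction \<open>(1 - z) \<circ> 1_S\<close>. The
  gradient is given only relative to the cube, so the derivative is one-sided at the ends of
  \<open>{0..1}\<close>.\<close>

lemma has_derivative_along_move: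
  assumes grad: "\<And>x. x \<in> cube n \<Longrightarrow> has_gradient n f x (G x)"
    and z: "z \<in> cube n" "S \<subseteq> {..<n}" and t: "t \<in> {0..1}"
  shows "((\<lambda>t. f (move z S t)) has_real_derivative (\<Sum>i\<in>S. (1 - z i) * G (move z S t) i))
    (at t within {0..1})"
  unfolding has_field_derivative_def has_derivative_within_alt
proof (intro conjI allI impI)
  show "bounded_linear ((*) (\<Sum>i\<in>S. (1 - z i) * G (move z S t) i))" by (rule bounded_linear_mult_right)
  fix e :: real assume e: "e > 0"
  \<comment> \<open>The length of the direction. It may vanish, hence the divisions by
    \<open>D + 1\<close> below.\<close>
  define D where "D = L2_set (\<lambda>i. if i \<in> S then 1 - z i else 0) {..<n}"
  have D: "D \<ge> 0" by (simp add: D_def)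
  have dist: "L2_set (\<lambda>i. move z S s i - move z S t i) {..<n} = \<bar>s - t\<bar> * D" for s
  proof -
    have "(\<lambda>i. move z S s i - move z S t i) = (\<lambda>i. (s - t) * (if i \<in> S then 1 - z i else 0))"
      by (auto simp: move_def algebra_simps)
    then show ?thesis
      by (simp add: D_def L2_set_def power_mult_distrib real_sqrt_mult flip: sum_distrib_left)
  qed
  have lin: "(\<Sum>i<n. G (move z S t) i * (move z S s i - move z S t i)) =
      (\<Sum>i\<in>S. (1 - z i) * G (move z S t) i) * (s - t)" for s
  proof -
    have "(\<Sum>i<n. G (move z S t) i * (move z S s i - move z S t i)) =
      (\<Sum>i\<in>S. G (move z S t) i * (move z S s i - move z S t i))"
      using z(2) by (intro sum.mono_neutral_right) (auto simp: move_def)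
    also have "\<dots> = (\<Sum>i\<in>S. ((1 - z i) * G (move z S t) i) * (s - t))"
      by (intro sum.cong) (auto simp: move_def algebra_simps)
    finally show ?thesis by (simp add: sum_distrib_right)
  qed
  have "e / (D + 1) > 0" using e D by simp
  moreover have "move z S t \<in> cube n" using move_in_cube[OF z] t by auto
  ultimately obtain d where d: "d > 0"
    and dd: "\<And>y. y \<in> cube n \<Longrightarrow> L2_set (\<lambda>i. y i - move z S t i) {..<n} < d \<Longrightarrow>
      \<bar>f y - f (move z S t) - (\<Sum>i<n. G (move z S t) i * (y i - move z S t i))\<bar>
        \<le> e / (D + 1) * L2_set (\<lambda>i. y i - move z S t i) {..<n}"
    using grad unfolding has_gradient_def by meson
  show "\<exists>d>0. \<forall>s\<in>{0..1}. norm (s - t) < d \<longrightarrow>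
      norm (f (move z S s) - f (move z S t) - (\<Sum>i\<in>S. (1 - z i) * G (move z S t) i) * (s - t))
        \<le> e * norm (s - t)"
  proof (intro exI[of _ "d / (D + 1)"] conjI ballI impI)
    fix s :: real assume s: "s \<in> {0..1}" "norm (s - t) < d / (D + 1)"
    have "\<bar>s - t\<bar> * D \<le> \<bar>s - t\<bar> * (D + 1)" by (intro mult_left_mono) auto
    also have "\<dots> < d" using s(2) D by (simp add: field_simps)
    finally have "\<bar>s - t\<bar> * D < d" .
    moreover have "move z S s \<in> cube n" using move_in_cube[OF z] s by auto
    ultimately have "\<bar>f (move z S s) - f (move z S t) - (\<Sum>i\<in>S. (1 - z i) * G (move z S t) i) * (s - t)\<bar>
        \<le> e / (D + 1) * (\<bar>s - t\<bar> * D)"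
      using dd[of "move z S s"] by (simp add: dist lin)
    also have "\<dots> = e * \<bar>s - t\<bar> * (D / (D + 1))" by simp
    also have "\<dots> \<le> e * \<bar>s - t\<bar> * 1" using e D by (intro mult_left_mono) auto
    finally show "norm (f (move z S s) - f (move z S t) - (\<Sum>i\<in>S. (1 - z i) * G (move z S t) i) * (s - t))
        \<le> e * norm (s - t)" by simp
  qed (use d D in simp)
qed

section \<open>Scaled marginals along a move: monotonicity and continuity\<close>

text \<open>The set \<open>S\<^sup>+\<close> of the counting argument.\<close>

definition strictly_active :: "nat \<Rightarrow> (vector \<Rightarrow> vector) \<Rightarrow> real \<Rightarrow> config \<Rightarrow> nat set" where
  "strictly_active n G \<epsilon> c = {i \<in> active n G \<epsilon> c. scaled_gradient G (zvec c) i > vcur c}"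

text \<open>The bound \<open>1 / 2\<close> comes from \<open>1 / \<epsilon>\<close> being an integer
  greater than 1.\<close>

locale DR_submodular =
  fixes n :: nat and f :: "vector \<Rightarrow> real" and G :: "vector \<Rightarrow> vector" and \<epsilon> :: real
  assumes DR: "differentiable_DR_submodular n f G"
    and eps: "0 < \<epsilon>" "\<epsilon> \<le> 1 / 2"
begin

lemma eps_square: "0 < \<epsilon>\<^sup>2" "\<epsilon>\<^sup>2 < 1"
  using eps by (auto intro: power_Suc_less_one[of \<epsilon> 1, simplified, folded power2_eq_square])

lemma gradient_antitone:
  "x \<in> cube n \<Longrightarrow> y \<in> cube n \<Longrightarrow> (\<And>i. i < n \<Longrightarrow> x i \<le> y i) \<Longrightarrow> i < n \<Longrightarrow> G y i \<le> G x i"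
  using DR unfolding differentiable_DR_submodular_def by blast

text \<open>Positivity at the larger point \<open>y\<close> makes both factors positive there, and
  neither decreases on the way down to \<open>x\<close>. With a negative partial derivative, the
  shrinking factor \<open>1 - z i\<close> could make the product grow.\<close>

lemma scaled_gradient_antitone:
  assumes "x \<in> cube n" "y \<in> cube n" "\<And>i. i < n \<Longrightarrow> x i \<le> y i" "i < n" "0 < scaled_gradient G y i"
  shows "scaled_gradient G y i \<le> scaled_gradient G x i"
    and "x i < y i \<Longrightarrow> scaled_gradient G y i < scaled_gradient G x i"
proof -
  have "y i \<le> 1" using assms by (auto simp: cube_def)
  then have y: "1 - y i > 0" "G y i > 0"
    using assms(5) by (auto simp: scaled_gradient_def zero_less_mult_iff)
  have G: "G y i \<le> G x i" using gradient_antitone[OF assms(1-4)] .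
  show "scaled_gradient G y i \<le> scaled_gradient G x i"
    using y G assms(3)[OF assms(4)] by (auto simp: scaled_gradient_def intro!: mult_mono)
  show "scaled_gradient G y i < scaled_gradient G x i" if "x i < y i"
    using y G that by (auto simp: scaled_gradient_def intro!: mult_less_le_imp_less)
qed

text \<open>The derivative of \<open>f\<close> along the move is a sum of antitone terms, so no
  single term can jump; the remaining factor \<open>1 - t\<close> is continuous.\<close>

lemma continuous_on_scaled_gradient_move:
  assumes z: "z \<in> cube n" "S \<subseteq> {..<n}" and i: "i \<in> S"
  shows "continuous_on {0..1} (\<lambda>t. scaled_gradient G (move z S t) i)"
proof -
  define h where "h j t = (1 - z j) * G (move z S t) j" for j t
  have fin: "finite S" using z(2) finite_subset by blast
  have h: "h j t \<le> h j s" if "0 \<le> s" "s \<le> t" "t \<le> 1" "j \<in> S" for j s t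
  proof -
    have "G (move z S t) j \<le> G (move z S s) j"
      using that z by (intro gradient_antitone move_in_cube move_mono[OF z]) auto
    moreover have "z j \<le> 1" using z that by (auto simp: cube_def)
    ultimately show ?thesis by (simp add: h_def mult_left_mono)
  qed
  have "continuous_on {0..1} (h i)"
  proof (rule antitone_summand_of_derivative_continuous)
    show "((\<lambda>t. f (move z S t)) has_real_derivative (\<Sum>j\<in>S. h j t)) (at t within {0..1})"
      if "t \<in> {0..1}" for t
      unfolding h_def using DR that z
      by (intro has_derivative_along_move) (auto simp: differentiable_DR_submodular_def)
    show "(\<Sum>j\<in>S. h j t) - h i t \<le> (\<Sum>j\<in>S. h j s) - h i s" if "0 \<le> s" "s \<le> t" "t \<le> 1" for s t
      using h[OF that] by (auto simp: sum.remove[OF fin i] intro!: sum_mono)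
  qed (use h i in auto)
  then have "continuous_on {0..1} (\<lambda>t. (1 - t) * h i t)" by (intro continuous_intros)
  moreover have "(\<lambda>t. scaled_gradient G (move z S t) i) = (\<lambda>t. (1 - t) * h i t)"
    using i by (auto simp: scaled_gradient_def one_minus_move h_def)
  ultimately show ?thesis by metis
qed

section \<open>The two step sizes as attained maxima\<close>

text \<open>The admissible \<open>t\<close> form a finite union of closed sets, one for each large
  enough \<open>A \<subseteq> S\<close> whose marginals stay at least \<open>v\<close>. The value 0
  is admissible because all of \<open>S\<close> starts with marginals at least
  \<open>v\<close>.\<close>

lemma eta1_greatest:
  assumes z: "zvec c \<in> cube n" and S: "S \<subseteq> active n G \<epsilon> c"
  shows "eta1 G \<epsilon> c S \<in> {0..\<epsilon>\<^sup>2}"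
    and "(1 - \<epsilon>) * real (card S) \<le> real (card (S_eta G c S (eta1 G \<epsilon> c S)))"
    and "\<And>t. eta1 G \<epsilon> c S < t \<Longrightarrow> t \<le> \<epsilon>\<^sup>2 \<Longrightarrow> real (card (S_eta G c S t)) < (1 - \<epsilon>) * real (card S)"
proof -
  let ?P = "\<lambda>t. t \<in> {0..\<epsilon>\<^sup>2} \<and> (1 - \<epsilon>) * real (card S) \<le> real (card (S_eta G c S t))"
  have Sn: "S \<subseteq> {..<n}" using S by (auto simp: active_def)
  then have fin: "finite S" using finite_subset by blast
  define \<A> where "\<A> = {A \<in> Pow S. (1 - \<epsilon>) * real (card S) \<le> real (card A)}"
  have "{t. ?P t} = (\<Union>A\<in>\<A>. {t \<in> {0..\<epsilon>\<^sup>2}. \<forall>i\<in>A. vcur c \<le> scaled_gradient G (move (zvec c) S t) i})"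
    (is "_ = ?U")
  proof (intro equalityI subsetI)
    fix t assume "t \<in> {t. ?P t}"
    moreover from this have "S_eta G c S t \<in> \<A>" by (auto simp: \<A>_def S_eta_def)
    ultimately show "t \<in> ?U" by (intro UN_I[of "S_eta G c S t"]) (auto simp: S_eta_def)
  next
    fix t assume "t \<in> ?U"
    then obtain A where A: "A \<in> \<A>" "t \<in> {0..\<epsilon>\<^sup>2}" "A \<subseteq> S_eta G c S t"
      by (auto simp: \<A>_def S_eta_def)
    then have "card A \<le> card (S_eta G c S t)"
      using fin by (intro card_mono) (auto simp: S_eta_def)
    then show "t \<in> {t. ?P t}" using A by (auto simp: \<A>_def)
  qed
  moreover have "closed {t \<in> {0..\<epsilon>\<^sup>2}. \<forall>i\<in>A. vcur c \<le> scaled_gradient G (move (zvec c) S t) i}"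
    if "A \<in> \<A>" for A
  proof -
    have "{t \<in> {0..\<epsilon>\<^sup>2}. \<forall>i\<in>A. vcur c \<le> scaled_gradient G (move (zvec c) S t) i} =
      {0..\<epsilon>\<^sup>2} \<inter> (\<Inter>i\<in>A. {t \<in> {0..\<epsilon>\<^sup>2}. vcur c \<le> scaled_gradient G (move (zvec c) S t) i})" by auto
    moreover have "closed {t \<in> {0..\<epsilon>\<^sup>2}. vcur c \<le> scaled_gradient G (move (zvec c) S t) i}"
      if "i \<in> A" for i
    proof (intro continuous_on_closed_Collect_le continuous_on_const closed_atLeastAtMost)
      have "continuous_on {0..1} (\<lambda>t. scaled_gradient G (move (zvec c) S t) i)"
        using \<open>A \<in> \<A>\<close> that by (intro continuous_on_scaled_gradient_move z Sn) (auto simp: \<A>_def)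
      then show "continuous_on {0..\<epsilon>\<^sup>2} (\<lambda>t. scaled_gradient G (move (zvec c) S t) i)"
        using eps_square by (auto elim: continuous_on_subset)
    qed
    ultimately show ?thesis by (auto intro!: closed_Int closed_INT)
  qed
  moreover have "finite \<A>" using fin by (simp add: \<A>_def)
  ultimately have "closed {t. ?P t}" by (simp add: closed_UN)
  moreover have "bounded {t. ?P t}" by (rule bounded_subset[OF bounded_closed_interval[of 0 "\<epsilon>\<^sup>2"]]) auto
  ultimately have "compact {t. ?P t}" by (simp add: compact_eq_bounded_closed)
  moreover have "?P 0"
  proof -
    have "S_eta G c S 0 = S" using S by (auto simp: S_eta_def active_def)
    moreover have "(1 - \<epsilon>) * real (card S) \<le> 1 * real (card S)"
      using eps by (intro mult_right_mono) auto
    ultimately show ?thesis using eps by auto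
  qed
  ultimately have *: "?P (eta1 G \<epsilon> c S)" "\<And>t. ?P t \<Longrightarrow> t \<le> eta1 G \<epsilon> c S"
    unfolding eta1_def by (rule Greatest_compact)+
  show "eta1 G \<epsilon> c S \<in> {0..\<epsilon>\<^sup>2}"
    "(1 - \<epsilon>) * real (card S) \<le> real (card (S_eta G c S (eta1 G \<epsilon> c S)))" using *(1) by auto
  show "real (card (S_eta G c S t)) < (1 - \<epsilon>) * real (card S)" if "eta1 G \<epsilon> c S < t" "t \<le> \<epsilon>\<^sup>2" for t
  proof (rule ccontr)
    assume "\<not> ?thesis"
    then have "?P t" using that *(1) by auto
    then show False using *(2) that by fastforce
  qed
qed

lemma norm1_move_continuous: "continuous_on A (\<lambda>t. norm1 n (move z S t))"
proof -
  have "continuous_on A (\<lambda>t. \<bar>move z S t i\<bar>)" for i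
    by (cases "i \<in> S") (auto simp: move_def intro!: continuous_intros)
  then show ?thesis unfolding norm1_def by (intro continuous_on_sum)
qed

text \<open>Slack in the norm at a step below \<open>\<epsilon>\<^sup>2\<close> would, by the
  intermediate value theorem, allow a longer step.\<close>

lemma eta2_greatest:
  assumes less: "norm1 n (zvec c) < \<epsilon> * real (phase c) * k"
  shows "eta2 n k \<epsilon> c S \<in> {0..\<epsilon>\<^sup>2}"
    and "eta2 n k \<epsilon> c S < \<epsilon>\<^sup>2 \<Longrightarrow>
      norm1 n (move (zvec c) S (eta2 n k \<epsilon> c S)) = \<epsilon> * real (phase c) * k"
proof -
  let ?g = "\<lambda>t. norm1 n (move (zvec c) S t)" and ?L = "\<epsilon> * real (phase c) * k"
  let ?P = "\<lambda>t. t \<in> {0..\<epsilon>\<^sup>2} \<and> ?g t \<le> ?L"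
  have "closed {t. ?P t}"
    using continuous_on_closed_Collect_le[OF norm1_move_continuous continuous_on_const closed_atLeastAtMost]
    by simp
  moreover have "bounded {t. ?P t}" by (rule bounded_subset[OF bounded_closed_interval[of 0 "\<epsilon>\<^sup>2"]]) auto
  ultimately have "compact {t. ?P t}" by (simp add: compact_eq_bounded_closed)
  moreover have "?P 0" using less by simp
  ultimately have *: "?P (eta2 n k \<epsilon> c S)" "\<And>t. ?P t \<Longrightarrow> t \<le> eta2 n k \<epsilon> c S"
    unfolding eta2_def by (rule Greatest_compact)+
  show "eta2 n k \<epsilon> c S \<in> {0..\<epsilon>\<^sup>2}" using *(1) by auto
  show "?g (eta2 n k \<epsilon> c S) = ?L" if "eta2 n k \<epsilon> c S < \<epsilon>\<^sup>2"
  proof (rule ccontr)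
    assume "?g (eta2 n k \<epsilon> c S) \<noteq> ?L"
    then have lt: "?g (eta2 n k \<epsilon> c S) < ?L" using *(1) by auto
    have "\<exists>t>eta2 n k \<epsilon> c S. t \<le> \<epsilon>\<^sup>2 \<and> ?g t \<le> ?L"
    proof (cases "?g (\<epsilon>\<^sup>2) \<le> ?L")
      case False
      then have "\<exists>t\<ge>eta2 n k \<epsilon> c S. t \<le> \<epsilon>\<^sup>2 \<and> ?g t = ?L"
        using lt that by (intro IVT' norm1_move_continuous) auto
      then show ?thesis using lt by (metis less_irrefl order.order_iff_strict)
    qed (use that in auto)
    then obtain t where "t > eta2 n k \<epsilon> c S" "t \<le> \<epsilon>\<^sup>2" "?g t \<le> ?L" by blast
    then show False using *(1) *(2)[of t] by auto
  qed
qed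

section \<open>One iteration with nonempty \<open>S\<close>\<close>

text \<open>
  The hypothesis \<open>f (zvec c) \<le> f (xvec c)\<close> holds throughout the execution; it makes a step of size
  \<open>0\<close> leave the whole state unchanged.
\<close>

lemma iteration_step:
  assumes z: "zvec c \<in> cube n" and fx: "f (zvec c) \<le> f (xvec c)" and v: "0 < vcur c"
    and less: "norm1 n (zvec c) < \<epsilon> * real (phase c) * k"
    and ne: "active n G \<epsilon> c \<noteq> {}" and moves: "iteration n f G k \<epsilon> c \<noteq> c"
  defines "c' \<equiv> iteration n f G k \<epsilon> c"
  obtains \<eta> where "0 < \<eta>" "\<eta> \<le> \<epsilon>\<^sup>2" "zvec c' = move (zvec c) (active n G \<epsilon> c) \<eta>"
    "phase c' = phase c" "vcur c' = vcur c" "vstart c' = vstart c" "zstart c' = zstart c"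
    "f (zvec c') \<le> f (xvec c')"
    "active n G \<epsilon> c' \<subseteq> strictly_active n G \<epsilon> c" "strictly_active n G \<epsilon> c \<noteq> {}"
    "\<eta> = \<epsilon>\<^sup>2 \<or> norm1 n (zvec c') = \<epsilon> * real (phase c') * k \<or>
      real (card (strictly_active n G \<epsilon> c')) \<le> (1 - \<epsilon>) * real (card (active n G \<epsilon> c))"
proof -
  define S where "S = active n G \<epsilon> c"
  define \<eta> where "\<eta> = min (eta1 G \<epsilon> c S) (eta2 n k \<epsilon> c S)"
  define x where "x = move (xvec c) (T_eta G c S \<eta>) \<eta>"
  define z' where "z' = move (zvec c) S \<eta>"
  have c': "c' = c\<lparr>xvec := (if f z' > f x then z' else x), zvec := z'\<rparr>"
    using ne unfolding c'_def iteration_def Let_def S_def \<eta>_def x_def z'_def by simp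
  have Sn: "S \<subseteq> {..<n}" by (auto simp: S_def active_def)
  have fin: "finite S" using Sn finite_subset by blast
  have "S \<subseteq> active n G \<epsilon> c" by (simp add: S_def)
  note e1 = eta1_greatest[OF z this]
  note e2 = eta2_greatest[OF less, of S]
  have eta: "\<eta> \<ge> 0" "\<eta> \<le> \<epsilon>\<^sup>2" using e1(1) e2(1) by (auto simp: \<eta>_def)
  have "\<eta> \<noteq> 0"
  proof
    assume "\<eta> = 0"
    then have "c' = c" using fx unfolding c' x_def z'_def by simp
    then show False using moves by (simp add: c'_def)
  qed
  then have pos: "\<eta> > 0" using eta by simp
  have path: "move (zvec c) S t \<in> cube n" if "t \<in> {0..\<epsilon>\<^sup>2}" for t
    using that eps_square by (intro move_in_cube z Sn) auto
  \<comment> \<open>Since \<open>v > 0\<close>, a coordinate of \<open>S\<close> has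
    \<open>z i < 1\<close> and truly moves, so a positive marginal falls strictly: being at least
    \<open>v\<close> after the move means having been above \<open>v\<close> before.\<close>
  have drop: "i \<in> strictly_active n G \<epsilon> c"
    if "i \<in> S" "0 < t" "t \<le> \<epsilon>\<^sup>2" "vcur c \<le> scaled_gradient G (move (zvec c) S t) i" for i t
  proof -
    have "zvec c i \<le> 1" using that z Sn by (auto simp: cube_def)
    moreover have "zvec c i \<noteq> 1" using that v by (auto simp: S_def active_def scaled_gradient_def)
    ultimately have "zvec c i < 1" by simp
    then have lt: "zvec c i < move (zvec c) S t i" using that by (simp add: move_def)
    have "scaled_gradient G (move (zvec c) S t) i < scaled_gradient G (zvec c) i"
    proof (rule scaled_gradient_antitone(2)[OF z path _ _ _ lt])
      show "zvec c j \<le> move (zvec c) S t j" for j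
        using move_mono[OF z Sn, of 0 t j] that by simp
    qed (use that v Sn in auto)
    then show ?thesis using that by (auto simp: strictly_active_def S_def)
  qed
  \<comment> \<open>Within a phase the caps on \<open>z\<close> are fixed and \<open>z\<close> only
    grows, so every requirement met after the step was met before it.\<close>
  have c'_active: "i \<in> S \<and> vcur c \<le> scaled_gradient G z' i" if "i \<in> active n G \<epsilon> c'" for i
  proof -
    have i: "i < n" "vcur c \<le> scaled_gradient G z' i" "z' i \<le> 1 - (1 - \<epsilon>) ^ phase c"
      "z' i - zstart c i < \<epsilon> * (1 - zstart c i)"
      using that by (auto simp: active_def c')
    have le: "zvec c j \<le> z' j" for j
      using move_mono[OF z Sn, of 0 \<eta> j] eta by (simp add: z'_def)
    have "scaled_gradient G z' i \<le> scaled_gradient G (zvec c) i"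
      using i v eta by (intro scaled_gradient_antitone le z path[of \<eta>, folded z'_def]) auto
    then show ?thesis using i le[of i] by (auto simp: S_def active_def)
  qed
  show thesis
  proof (rule that[of \<eta>])
    show "active n G \<epsilon> c' \<subseteq> strictly_active n G \<epsilon> c"
      using c'_active drop[OF _ pos eta(2)] by (auto simp: z'_def)
    \<comment> \<open>At \<open>eta1\<close>, which is at least \<open>\<eta> > 0\<close>, a
      positive fraction of \<open>S\<close> still reaches \<open>v\<close>; such a coordinate was
      strictly above \<open>v\<close> before.\<close>
    have "S_eta G c S (eta1 G \<epsilon> c S) \<noteq> {}"
    proof
      assume "S_eta G c S (eta1 G \<epsilon> c S) = {}"
      then have "(1 - \<epsilon>) * real (card S) \<le> 0" using e1(2) by simp
      moreover have "card S > 0" using ne fin by (simp add: S_def card_gt_0_iff)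
      ultimately show False using eps by (simp add: mult_le_0_iff)
    qed
    then obtain i where "i \<in> S" "vcur c \<le> scaled_gradient G (move (zvec c) S (eta1 G \<epsilon> c S)) i"
      by (auto simp: S_eta_def)
    then show "strictly_active n G \<epsilon> c \<noteq> {}" using drop pos e1(1) by (force simp: \<eta>_def)
    show "\<eta> = \<epsilon>\<^sup>2 \<or> norm1 n (zvec c') = \<epsilon> * real (phase c') * k \<or>
      real (card (strictly_active n G \<epsilon> c')) \<le> (1 - \<epsilon>) * real (card (active n G \<epsilon> c))"
    proof (cases "\<eta> = \<epsilon>\<^sup>2 \<or> \<eta> = eta2 n k \<epsilon> c S")
      case True
      then show ?thesis using e2 eta by (auto simp: c' z'_def)
    next
      case False
      then have eta1: "\<eta> = eta1 G \<epsilon> c S" "\<eta> < \<epsilon>\<^sup>2" using eta by (auto simp: \<eta>_def min_def split: if_splits)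
      \<comment> \<open>The step now stops at \<open>eta1\<close>, short of
        \<open>\<epsilon>\<^sup>2\<close>. Strict inequalities persist by continuity slightly beyond
        it, where maximality of \<open>eta1\<close> bounds the number of survivors. Coordinates
        exactly at \<open>v\<close> need not persist, which is why \<open>S\<^sup>+\<close> is
        counted.\<close>
      define B where "B = {i \<in> S. vcur c < scaled_gradient G z' i}"
      have "\<forall>\<^sub>F t in at \<eta> within {0..1}. \<forall>i\<in>B. vcur c < scaled_gradient G (move (zvec c) S t) i"
      proof (intro eventually_ball_finite ballI)
        fix i assume i: "i \<in> B"
        then have "continuous_on {0..1} (\<lambda>t. scaled_gradient G (move (zvec c) S t) i)"
          by (intro continuous_on_scaled_gradient_move z Sn) (auto simp: B_def)
        then have "((\<lambda>t. scaled_gradient G (move (zvec c) S t) i) \<longlongrightarrow> scaled_gradient G z' i)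
          (at \<eta> within {0..1})"
          using eta eps_square by (auto simp: continuous_on_def z'_def)
        then show "\<forall>\<^sub>F t in at \<eta> within {0..1}. vcur c < scaled_gradient G (move (zvec c) S t) i"
          using i by (auto simp: B_def intro: order_tendstoD(1))
      qed (use fin in \<open>simp add: B_def\<close>)
      then obtain d where d: "d > 0" "\<And>t. t \<in> {0..1} \<Longrightarrow> t \<noteq> \<eta> \<Longrightarrow> dist t \<eta> < d \<Longrightarrow>
          \<forall>i\<in>B. vcur c < scaled_gradient G (move (zvec c) S t) i"
        unfolding eventually_at by blast
      define t where "t = min (\<epsilon>\<^sup>2) (\<eta> + d / 2)"
      have t: "\<eta> < t" "t \<le> \<epsilon>\<^sup>2" "dist t \<eta> < d" using d(1) eta1 by (auto simp: t_def dist_real_def)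
      then have "B \<subseteq> S_eta G c S t"
        using d(2)[of t] pos eps_square by (force simp: S_eta_def B_def)
      moreover have "strictly_active n G \<epsilon> c' \<subseteq> B"
        using c'_active by (auto simp: strictly_active_def B_def c')
      ultimately have "card (strictly_active n G \<epsilon> c') \<le> card (S_eta G c S t)"
        using fin by (intro card_mono) (auto simp: S_eta_def)
      then show ?thesis using e1(3)[of t] t eta1 by (simp add: S_def)
    qed
  qed (use pos eta in \<open>auto simp: c' z'_def S_def\<close>)
qed

section \<open>Progress and cost within one phase\<close>

text \<open>
  Within the current phase, \<open>m\<close> counts the reductions of \<open>v\<close>; since the last of them, \<open>a\<close> counts the
  steps of size \<open>\<epsilon>\<^sup>2\<close> and \<open>b\<close> those that shrank \<open>|S| |S\<^sup>+|\<close>. In \<open>cost\<close> below, the extra \<open>1\<close> pays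
  for the step of size \<open>\<eta>\<^sub>2\<close> that ends the phase.
\<close>

definition progress :: "config \<Rightarrow> nat \<Rightarrow> nat \<Rightarrow> nat \<Rightarrow> bool" where
  "progress c m a b \<longleftrightarrow>
     (\<forall>i. zstart c i \<le> zvec c i) \<and> vcur c = (1 - \<epsilon>) ^ m * vstart c \<and> (m = 0 \<or> 0 < vstart c) \<and>
     real m \<le> ln (1 / \<epsilon>) / \<epsilon> + 1 \<and> real a \<le> 2 / \<epsilon> + 1 \<and> real b \<le> 2 * ln (real n) / \<epsilon> + 1 \<and>
     (\<forall>i\<in>active n G \<epsilon> c. 1 - zvec c i \<le> (1 - \<epsilon>\<^sup>2) ^ a * (1 - zstart c i)) \<and>
     real (card (active n G \<epsilon> c)) * real (card (strictly_active n G \<epsilon> c)) \<le> (real n)\<^sup>2 * (1 - \<epsilon>) ^ b"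

lemma finite_active: "finite (active n G \<epsilon> c)" "finite (strictly_active n G \<epsilon> c)"
  by (auto simp: active_def strictly_active_def)

lemma card_active_product:
  "real (card (active n G \<epsilon> c)) * real (card (strictly_active n G \<epsilon> c)) \<le> (real n)\<^sup>2"
proof -
  have "card (active n G \<epsilon> c) \<le> card {..<n}" "card (strictly_active n G \<epsilon> c) \<le> card {..<n}"
    by (intro card_mono; auto simp: active_def strictly_active_def)+
  then show ?thesis unfolding power2_eq_square by (intro mult_mono) auto
qed

lemma ln_inverse_eps_nonneg: "0 \<le> ln (1 / \<epsilon>) / \<epsilon>"
  using eps by simp

lemma progress_enter_phase:
  assumes "1 \<le> n"
  shows "progress (enter_phase f k \<epsilon> M j x z) 0 0 0"
  using eps assms card_active_product ln_inverse_eps_nonneg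
  by (auto simp: progress_def enter_phase_def Let_def)

text \<open>With no reduction made, the loop condition reads
  \<open>(1 - \<epsilon>) * vstart > 0\<close>, so a nonpositive \<open>vstart\<close> never enters
  the loop. The bound on \<open>m\<close> is one better than in \<open>progress\<close>, leaving
  room for the next reduction.\<close>

lemma progress_threshold:
  assumes "progress c m a b" "loop_cond n k \<epsilon> c"
  shows "0 < vstart c" "0 < vcur c" "real m \<le> ln (1 / \<epsilon>) / \<epsilon>"
proof -
  have v: "vcur c = (1 - \<epsilon>) ^ m * vstart c" "m = 0 \<or> 0 < vstart c" "vcur c > \<epsilon> * vstart c"
    using assms by (auto simp: progress_def loop_cond_def)
  have "0 < (1 - \<epsilon>) * vstart c" if "m = 0" using v that by (simp add: algebra_simps)
  then show pos: "0 < vstart c" using v(2) eps by (auto simp: zero_less_mult_iff)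
  then show "0 < vcur c" using v(1) eps by simp
  have "\<epsilon> \<le> (1 - \<epsilon>) ^ m" using v pos by simp
  then have "real m * \<epsilon> \<le> ln (1 / \<epsilon>)" using eps by (intro geometric_exponent_bound) auto
  then show "real m \<le> ln (1 / \<epsilon>) / \<epsilon>" using eps by (simp add: pos_le_divide_eq)
qed

text \<open>For a coordinate still active, \<open>1 - z i\<close> exceeds
  \<open>(1 - \<epsilon>) * (1 - zstart i)\<close>, whereas \<open>a\<close> full steps bring it
  down to at most \<open>(1 - \<epsilon>\<^sup>2) ^ a * (1 - zstart i)\<close>.\<close>

lemma progress_full_steps:
  assumes c: "progress c m a b" "0 < vcur c" "zvec c \<in> cube n" and i: "i \<in> active n G \<epsilon> c"
  shows "real a \<le> 2 / \<epsilon>"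
proof -
  have "zvec c i \<le> 1" using c i by (auto simp: cube_def active_def)
  moreover have "zvec c i \<noteq> 1" using c i by (auto simp: active_def scaled_gradient_def)
  ultimately have z: "0 < 1 - zvec c i" by simp
  have le: "1 - zvec c i \<le> (1 - \<epsilon>\<^sup>2) ^ a * (1 - zstart c i)" using c i by (simp add: progress_def)
  have "0 < (1 - \<epsilon>\<^sup>2) ^ a * (1 - zstart c i)" using z le by linarith
  then have zs: "0 < 1 - zstart c i" using eps_square by (auto simp: zero_less_mult_iff)
  have "(1 - \<epsilon>) * (1 - zstart c i) \<le> 1 - zvec c i"
    using i by (simp add: active_def algebra_simps)
  then have "(1 - \<epsilon>) * (1 - zstart c i) \<le> (1 - \<epsilon>\<^sup>2) ^ a * (1 - zstart c i)" using le by linarith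
  then have "1 - \<epsilon> \<le> (1 - \<epsilon>\<^sup>2) ^ a" using zs by simp
  then have "real a * \<epsilon>\<^sup>2 \<le> ln (1 / (1 - \<epsilon>))"
    using eps eps_square by (intro geometric_exponent_bound) auto
  also have "\<dots> \<le> 2 * \<epsilon>"
  proof -
    \<comment> \<open>Both this logarithm bound and
      \<open>2 * \<epsilon>\<^sup>2 \<le> \<epsilon>\<close> rest on
      \<open>\<epsilon> \<le> 1 / 2\<close>.\<close>
    have "- \<epsilon> - 2 * \<epsilon>\<^sup>2 \<le> ln (1 - \<epsilon>)" using eps by (intro ln_one_minus_pos_lower_bound) auto
    moreover have "2 * \<epsilon>\<^sup>2 \<le> \<epsilon>" using eps by (simp add: power2_eq_square)
    ultimately show ?thesis using eps by (simp add: ln_div)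
  qed
  finally show ?thesis using eps by (simp add: power2_eq_square pos_le_divide_eq)
qed

text \<open>The product of two nonzero cardinalities is at least 1, yet at most
  \<open>n\<^sup>2 * (1 - \<epsilon>) ^ b\<close>.\<close>

lemma progress_shrinking_steps:
  assumes c: "progress c m a b" and ne: "strictly_active n G \<epsilon> c \<noteq> {}"
  shows "real b \<le> 2 * ln (real n) / \<epsilon>"
proof -
  have "active n G \<epsilon> c \<noteq> {}" using ne by (auto simp: strictly_active_def)
  then have "0 < card (active n G \<epsilon> c) * card (strictly_active n G \<epsilon> c)"
    using ne finite_active by (simp add: card_gt_0_iff)
  then have "1 \<le> real (card (active n G \<epsilon> c) * card (strictly_active n G \<epsilon> c))" by linarith
  also have "\<dots> \<le> (real n)\<^sup>2 * (1 - \<epsilon>) ^ b" using c by (simp add: progress_def)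
  finally have ge: "1 \<le> (real n)\<^sup>2 * (1 - \<epsilon>) ^ b" .
  then have n: "0 < real n" by (cases "n = 0") auto
  have "1 / (real n)\<^sup>2 \<le> (1 - \<epsilon>) ^ b" using ge n by (simp add: divide_le_eq mult.commute)
  then have "real b * \<epsilon> \<le> ln (1 / (1 / (real n)\<^sup>2))"
    using eps n by (intro geometric_exponent_bound) auto
  also have "\<dots> = 2 * ln (real n)" using n by (simp add: ln_realpow)
  finally show ?thesis using eps by (simp add: pos_le_divide_eq)
qed

text \<open>Bounds \<open>a + b + 1\<close> for a single value of \<open>v\<close>: the 3 collects
  the \<open>+ 1\<close> in the bounds on \<open>a\<close> and on \<open>b\<close>, and one unit for
  the reduction of \<open>v\<close> or the exit from the phase.\<close>

definition threshold_cost :: real where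
  "threshold_cost = 2 / \<epsilon> + 2 * ln (real n) / \<epsilon> + 3"

definition cost :: "real \<Rightarrow> config \<Rightarrow> nat \<Rightarrow> nat \<Rightarrow> nat \<Rightarrow> real" where
  "cost k c m a b =
     real m * threshold_cost + real a + real b + (if loop_cond n k \<epsilon> c then 0 else 1)"

text \<open>\<open>cost\<close> acts as a potential. An empty \<open>S\<close> raises
  \<open>m\<close>; otherwise the three alternatives for the step raise \<open>a\<close>, the exit
  term or \<open>b\<close>.\<close>

lemma progress_iteration:
  assumes c: "progress c m a b" "loop_cond n k \<epsilon> c" and n: "1 \<le> n"
    and z: "zvec c \<in> cube n" "f (zvec c) \<le> f (xvec c)" and moves: "iteration n f G k \<epsilon> c \<noteq> c"
  defines "c' \<equiv> iteration n f G k \<epsilon> c"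
  shows "zvec c' \<in> cube n" "f (zvec c') \<le> f (xvec c')" "phase c' = phase c"
    and "\<exists>m' a' b'. progress c' m' a' b' \<and> cost k c m a b + 1 \<le> cost k c' m' a' b'"
proof -
  have v: "0 < vstart c" "0 < vcur c" "real m \<le> ln (1 / \<epsilon>) / \<epsilon>"
    using progress_threshold[OF c] by auto
  have "zvec c' \<in> cube n \<and> f (zvec c') \<le> f (xvec c') \<and> phase c' = phase c \<and>
    (\<exists>m' a' b'. progress c' m' a' b' \<and> cost k c m a b + 1 \<le> cost k c' m' a' b')"
  proof (cases "active n G \<epsilon> c = {}")
    case True
    then have c': "c' = c\<lparr>vcur := (1 - \<epsilon>) * vcur c\<rparr>" by (simp add: c'_def iteration_def)
    have "progress c' (Suc m) 0 0"
      using c v n eps card_active_product[of c']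
      by (auto simp: progress_def c')
    moreover have "cost k c m a b + 1 \<le> cost k c' (Suc m) 0 0"
    proof -
      \<comment> \<open>Resetting \<open>a\<close> and \<open>b\<close> to 0 is paid for by the
        additional \<open>threshold_cost\<close> from \<open>m\<close>, with one unit to
        spare.\<close>
      have "real a + real b + 1 \<le> threshold_cost"
        using c(1) by (simp add: progress_def threshold_cost_def)
      then show ?thesis using c(2) by (simp add: cost_def algebra_simps)
    qed
    ultimately show ?thesis using z c' by auto
  next
    case False
    have less: "norm1 n (zvec c) < \<epsilon> * real (phase c) * k" using c(2) by (simp add: loop_cond_def)
    obtain \<eta> where s: "0 < \<eta>" "\<eta> \<le> \<epsilon>\<^sup>2" "zvec c' = move (zvec c) (active n G \<epsilon> c) \<eta>"
      "phase c' = phase c" "vcur c' = vcur c" "vstart c' = vstart c" "zstart c' = zstart c"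
      "f (zvec c') \<le> f (xvec c')"
      "active n G \<epsilon> c' \<subseteq> strictly_active n G \<epsilon> c" "strictly_active n G \<epsilon> c \<noteq> {}"
      "\<eta> = \<epsilon>\<^sup>2 \<or> norm1 n (zvec c') = \<epsilon> * real (phase c') * k \<or>
        real (card (strictly_active n G \<epsilon> c')) \<le> (1 - \<epsilon>) * real (card (active n G \<epsilon> c))"
      using iteration_step[OF z v(2) less False moves] unfolding c'_def by metis
    have cube: "zvec c' \<in> cube n"
      unfolding s(3) using s(1,2) eps_square z by (intro move_in_cube) (auto simp: active_def)
    have sub: "strictly_active n G \<epsilon> c \<subseteq> active n G \<epsilon> c" "strictly_active n G \<epsilon> c' \<subseteq> active n G \<epsilon> c'"
      by (auto simp: strictly_active_def)
    have cards: "card (active n G \<epsilon> c') \<le> card (strictly_active n G \<epsilon> c)"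
      "card (active n G \<epsilon> c') \<le> card (active n G \<epsilon> c)"
      "card (strictly_active n G \<epsilon> c') \<le> card (strictly_active n G \<epsilon> c)"
      using s(9) sub finite_active by (auto intro!: card_mono)
    obtain i0 where "i0 \<in> active n G \<epsilon> c" using False by auto
    then have a: "real a \<le> 2 / \<epsilon>" using progress_full_steps c(1) v(2) z(1) by blast
    have b: "real b \<le> 2 * ln (real n) / \<epsilon>" using progress_shrinking_steps c(1) s(10) by blast
    \<comment> \<open>The new active set lies in the old one, so each of its coordinates took part
      in the move.\<close>
    have shrink: "1 - zvec c' i = (1 - \<eta>) * (1 - zvec c i)"
      and old: "1 - zvec c i \<le> (1 - \<epsilon>\<^sup>2) ^ a * (1 - zstart c i)" and le1: "0 \<le> 1 - zvec c i"
      if "i \<in> active n G \<epsilon> c'" for i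
    proof -
      have i: "i \<in> active n G \<epsilon> c" using that s(9) sub by auto
      then show "1 - zvec c' i = (1 - \<eta>) * (1 - zvec c i)" by (simp add: s(3) one_minus_move)
      show "1 - zvec c i \<le> (1 - \<epsilon>\<^sup>2) ^ a * (1 - zstart c i)" using c(1) i by (simp add: progress_def)
      show "0 \<le> 1 - zvec c i" using i z(1) by (auto simp: active_def cube_def)
    qed
    have keep_a: "\<forall>i\<in>active n G \<epsilon> c'. 1 - zvec c' i \<le> (1 - \<epsilon>\<^sup>2) ^ a * (1 - zstart c' i)"
    proof
      fix i assume i: "i \<in> active n G \<epsilon> c'"
      have "(1 - \<eta>) * (1 - zvec c i) \<le> 1 * (1 - zvec c i)"
        using s(1) le1[OF i] by (intro mult_right_mono) auto
      then show "1 - zvec c' i \<le> (1 - \<epsilon>\<^sup>2) ^ a * (1 - zstart c' i)"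
        unfolding shrink[OF i] s(7) using old[OF i] by (metis mult_1 order_trans)
    qed
    have old_b: "real (card (active n G \<epsilon> c)) * real (card (strictly_active n G \<epsilon> c))
        \<le> (real n)\<^sup>2 * (1 - \<epsilon>) ^ b"
      using c(1) by (simp add: progress_def)
    have "real (card (active n G \<epsilon> c')) * real (card (strictly_active n G \<epsilon> c'))
        \<le> real (card (active n G \<epsilon> c)) * real (card (strictly_active n G \<epsilon> c))"
      using cards by (intro mult_mono) auto
    then have keep_b: "real (card (active n G \<epsilon> c')) * real (card (strictly_active n G \<epsilon> c'))
        \<le> (real n)\<^sup>2 * (1 - \<epsilon>) ^ b"
      using old_b by linarith
    have base: "zstart c' i \<le> zvec c' i" "vcur c' = (1 - \<epsilon>) ^ m * vstart c'" "m = 0 \<or> 0 < vstart c'"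
      "real m \<le> ln (1 / \<epsilon>) / \<epsilon> + 1" for i
    proof -
      have "zstart c i \<le> zvec c i" using c(1) by (simp add: progress_def)
      also have "zvec c i \<le> zvec c' i"
        using move_mono[OF z(1), of "active n G \<epsilon> c" 0 \<eta> i] s(1,3) by (auto simp: active_def)
      finally show "zstart c' i \<le> zvec c' i" by (simp add: s(7))
    qed (use c(1) v(3) s(5,6) in \<open>auto simp: progress_def\<close>)
    have "\<exists>a' b'. progress c' m a' b' \<and> cost k c m a b + 1 \<le> cost k c' m a' b'"
      using s(11)
    proof (elim disjE)
      assume full: "\<eta> = \<epsilon>\<^sup>2"
      have "\<forall>i\<in>active n G \<epsilon> c'. 1 - zvec c' i \<le> (1 - \<epsilon>\<^sup>2) ^ Suc a * (1 - zstart c' i)"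
      proof
        fix i assume i: "i \<in> active n G \<epsilon> c'"
        have "(1 - \<epsilon>\<^sup>2) * (1 - zvec c i) \<le> (1 - \<epsilon>\<^sup>2) * ((1 - \<epsilon>\<^sup>2) ^ a * (1 - zstart c i))"
          using old[OF i] eps_square by (intro mult_left_mono) auto
        then show "1 - zvec c' i \<le> (1 - \<epsilon>\<^sup>2) ^ Suc a * (1 - zstart c' i)"
          unfolding shrink[OF i] s(7) full by (simp add: mult.assoc)
      qed
      then have "progress c' m (Suc a) b"
        using base a b keep_b unfolding progress_def by simp
      then show ?thesis using c(2) by (intro exI[of _ "Suc a"] exI[of _ b]) (simp add: cost_def)
    next
      assume "norm1 n (zvec c') = \<epsilon> * real (phase c') * k"
      \<comment> \<open>The budget is used up exactly, so the exit term of \<open>cost\<close> goes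
        from 0 to 1.\<close>
      then have "\<not> loop_cond n k \<epsilon> c'" by (simp add: loop_cond_def)
      moreover have "progress c' m a b" using base a b keep_a keep_b unfolding progress_def by simp
      ultimately show ?thesis using c(2) by (intro exI[of _ a] exI[of _ b]) (simp add: cost_def)
    next
      assume "real (card (strictly_active n G \<epsilon> c')) \<le> (1 - \<epsilon>) * real (card (active n G \<epsilon> c))"
      \<comment> \<open>The factors are compared crosswise: the new \<open>S\<close> with the old
        \<open>S\<^sup>+\<close>, the new \<open>S\<^sup>+\<close> with the old
        \<open>S\<close>.\<close>
      then have "real (card (active n G \<epsilon> c')) * real (card (strictly_active n G \<epsilon> c'))
          \<le> real (card (strictly_active n G \<epsilon> c)) * ((1 - \<epsilon>) * real (card (active n G \<epsilon> c)))"
        using cards by (intro mult_mono) auto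
      also have "\<dots> = (1 - \<epsilon>) * (real (card (active n G \<epsilon> c)) * real (card (strictly_active n G \<epsilon> c)))"
        by simp
      also have "\<dots> \<le> (1 - \<epsilon>) * ((real n)\<^sup>2 * (1 - \<epsilon>) ^ b)"
        using old_b eps by (intro mult_left_mono) auto
      also have "\<dots> = (real n)\<^sup>2 * (1 - \<epsilon>) ^ Suc b" by simp
      finally have "progress c' m a (Suc b)"
        using base a b keep_a unfolding progress_def by simp
      then show ?thesis using c(2) by (intro exI[of _ a] exI[of _ "Suc b"]) (simp add: cost_def)
    qed
    then show ?thesis using cube s by auto
  qed
  then show "zvec c' \<in> cube n" "f (zvec c') \<le> f (xvec c')" "phase c' = phase c"
    "\<exists>m' a' b'. progress c' m' a' b' \<and> cost k c m a b + 1 \<le> cost k c' m' a' b'"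
    by auto
qed

section \<open>Summation over the phases\<close>

text \<open>\<open>progress\<close> allows \<open>m\<close> up to
  \<open>ln (1 / \<epsilon>) / \<epsilon> + 1\<close>; one further \<open>threshold_cost\<close>
  covers \<open>a + b + 1\<close>.\<close>

definition phase_cost :: real where
  "phase_cost = (ln (1 / \<epsilon>) / \<epsilon> + 2) * threshold_cost"

lemma threshold_cost_nonneg: "1 \<le> n \<Longrightarrow> 0 \<le> threshold_cost"
  using eps by (simp add: threshold_cost_def)

lemma progress_cost:
  assumes "progress c m a b" "1 \<le> n"
  shows "cost k c m a b \<le> phase_cost"
proof -
  have "real m * threshold_cost \<le> (ln (1 / \<epsilon>) / \<epsilon> + 1) * threshold_cost"
    using assms threshold_cost_nonneg by (intro mult_right_mono) (auto simp: progress_def)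
  moreover have "real a + real b + 1 \<le> threshold_cost"
    using assms by (simp add: progress_def threshold_cost_def)
  moreover have "phase_cost = (ln (1 / \<epsilon>) / \<epsilon> + 1) * threshold_cost + threshold_cost"
    by (simp add: phase_cost_def algebra_simps)
  ultimately have "real m * threshold_cost + real a + real b + 1 \<le> phase_cost" by linarith
  then show ?thesis by (simp add: cost_def)
qed

text \<open>Induction along the run: each completed phase is charged \<open>phase_cost\<close>, the
  current one its \<open>cost\<close>. Not being stalled passes back to earlier states, since a
  stalled state is a fixed point of the iteration and never leaves the loop.\<close>

lemma reaches_cost:
  assumes "reaches n f G k \<epsilon> M N c" "\<not> stalled n f G k \<epsilon> c" "1 \<le> n" "1 / \<epsilon> \<in> \<int>"
  shows "1 \<le> phase c \<and> real (phase c) \<le> 1 / \<epsilon> \<and> zvec c \<in> cube n \<and> f (zvec c) \<le> f (xvec c) \<and>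
    (\<exists>m a b. progress c m a b \<and> real N \<le> (real (phase c) - 1) * phase_cost + cost k c m a b)"
  using assms(1,2)
proof (induction rule: reaches.induct)
  case start
  have "progress (enter_phase f k \<epsilon> M 1 (\<lambda>_. 0) (\<lambda>_. 0)) 0 0 0"
    using assms by (intro progress_enter_phase) auto
  moreover have "0 \<le> cost k (enter_phase f k \<epsilon> M 1 (\<lambda>_. 0) (\<lambda>_. 0)) 0 0 0"
    by (simp add: cost_def)
  ultimately show ?case
    using eps by (auto simp: enter_phase_def Let_def cube_def orthant_def)
next
  case (iterate N c)
  have moves: "iteration n f G k \<epsilon> c \<noteq> c"
    using iterate.hyps(2) iterate.prems by (auto simp: stalled_def)
  then have "\<not> stalled n f G k \<epsilon> c" by (simp add: stalled_def)
  with iterate.IH obtain m a b where IH: "1 \<le> phase c" "real (phase c) \<le> 1 / \<epsilon>" "zvec c \<in> cube n"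
      "f (zvec c) \<le> f (xvec c)" "progress c m a b"
      "real N \<le> (real (phase c) - 1) * phase_cost + cost k c m a b"
    by blast
  note step = progress_iteration[OF IH(5) iterate.hyps(2) assms(3) IH(3,4) moves]
  from step(4) obtain m' a' b' where "progress (iteration n f G k \<epsilon> c) m' a' b'"
      "cost k c m a b + 1 \<le> cost k (iteration n f G k \<epsilon> c) m' a' b'"
    by blast
  moreover from this have
    "real (Suc N) \<le> (real (phase c) - 1) * phase_cost + cost k (iteration n f G k \<epsilon> c) m' a' b'"
    using IH(6) by simp
  ultimately show ?case using step(1-3) IH(1,2) by auto
next
  case (next_phase N c)
  have "\<not> stalled n f G k \<epsilon> c" using next_phase.hyps(2) by (simp add: stalled_def)
  with next_phase.IH obtain m a b where IH: "1 \<le> phase c" "zvec c \<in> cube n"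
      "f (zvec c) \<le> f (xvec c)" "progress c m a b"
      "real N \<le> (real (phase c) - 1) * phase_cost + cost k c m a b"
    by blast
  define c' where "c' = enter_phase f k \<epsilon> M (Suc (phase c)) (xvec c) (zvec c)"
  have c': "phase c' = Suc (phase c)" "zvec c' = zvec c" "xvec c' = xvec c"
    by (auto simp: c'_def enter_phase_def Let_def)
  \<comment> \<open>Integrality turns \<open>phase c < 1 / \<epsilon>\<close> into a bound on the
    successor.\<close>
  obtain p where p: "1 / \<epsilon> = of_int p" using assms(4) by (auto elim: Ints_cases)
  then have "int (phase c) < p" using next_phase.hyps(3) by linarith
  then have "real (Suc (phase c)) \<le> 1 / \<epsilon>" using p by linarith
  moreover have "progress c' 0 0 0" unfolding c'_def using assms(3) by (rule progress_enter_phase)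
  moreover have "real N \<le> (real (phase c') - 1) * phase_cost + cost k c' 0 0 0"
  proof -
    have "0 \<le> cost k c' 0 0 0" by (simp add: cost_def)
    moreover have "real N \<le> real (phase c) * phase_cost"
      using IH(5) progress_cost[OF IH(4) assms(3), of k] by (simp add: algebra_simps)
    ultimately show ?thesis by (simp add: c')
  qed
  ultimately show ?case using IH c' unfolding c'_def[symmetric] by auto
qed

text \<open>Both logarithms are at least \<open>ln 2 \<ge> 2 / 3\<close> and
  \<open>1 / \<epsilon> \<ge> 2\<close>, which absorbs the lower-order terms into the factors 8 and
  \<open>5 / 2\<close>; their product is 20.\<close>

lemma reaches_bound:
  assumes "reaches n f G k \<epsilon> M N c" "\<not> stalled n f G k \<epsilon> c" "2 \<le> n" "1 / \<epsilon> \<in> \<int>"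
  shows "real N \<le> 20 * (ln (real n) * ln (1 / \<epsilon>) / \<epsilon> ^ 3)"
proof -
  have n: "1 \<le> n" using assms(3) by simp
  obtain m a b where c: "real (phase c) \<le> 1 / \<epsilon>" "progress c m a b"
      "real N \<le> (real (phase c) - 1) * phase_cost + cost k c m a b"
    using reaches_cost[OF assms(1,2) n assms(4)] by blast
  have l2: "2 / 3 \<le> ln (2 :: real)" by (rule ln2_ge_two_thirds)
  have "ln 2 \<le> ln (real n)" "ln 2 \<le> ln (1 / \<epsilon>)"
    using assms(3) eps by (auto simp: field_simps)
  then have l: "2 / 3 \<le> ln (real n)" "2 / 3 \<le> ln (1 / \<epsilon>)" using l2 by linarith+
  have e2: "2 \<le> 1 / \<epsilon>" using eps by (simp add: field_simps)
  have t: "threshold_cost \<le> 8 * (ln (real n) / \<epsilon>)"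
  proof -
    have "2 / 3 * (1 / \<epsilon>) \<le> ln (real n) * (1 / \<epsilon>)" using l eps by (intro mult_right_mono) auto
    then show ?thesis using e2 by (simp add: threshold_cost_def)
  qed
  have p: "ln (1 / \<epsilon>) / \<epsilon> + 2 \<le> 5 / 2 * (ln (1 / \<epsilon>) / \<epsilon>)"
  proof -
    have "2 / 3 * (1 / \<epsilon>) \<le> ln (1 / \<epsilon>) * (1 / \<epsilon>)" using l eps by (intro mult_right_mono) auto
    then show ?thesis using e2 by simp
  qed
  have phase_cost: "0 \<le> phase_cost"
    using threshold_cost_nonneg[OF n] ln_inverse_eps_nonneg by (simp add: phase_cost_def)
  have "real N \<le> real (phase c) * phase_cost"
    using c(3) progress_cost[OF c(2) n, of k] by (simp add: algebra_simps)
  also have "\<dots> \<le> 1 / \<epsilon> * phase_cost" using c(1) phase_cost by (rule mult_right_mono)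
  also have "\<dots> \<le> 1 / \<epsilon> * (5 / 2 * (ln (1 / \<epsilon>) / \<epsilon>) * (8 * (ln (real n) / \<epsilon>)))"
    unfolding phase_cost_def using t p l eps threshold_cost_nonneg[OF n]
    by (intro mult_left_mono mult_mono) auto
  also have "\<dots> = 20 * (ln (real n) * ln (1 / \<epsilon>) / \<epsilon> ^ 3)"
    by (simp add: power3_eq_cube)
  finally show ?thesis .
qed

end

text \<open>The bound holds at every reachable state that is not stalled, so a run that never stalls
  has at most this many iterations in total.\<close>

theorem theorem5:
  "\<exists>C::real. \<forall>(n::nat) (f :: vector \<Rightarrow> real) (G :: vector \<Rightarrow> vector) (k::real) (\<epsilon>::real) (M::real)
      (xopt :: vector) (N::nat) (c::config).
      2 \<le> n \<longrightarrow> 0 < k \<longrightarrow> 0 < \<epsilon> \<longrightarrow> \<epsilon> < 1 \<longrightarrow> 1 / \<epsilon> \<in> \<int> \<longrightarrow>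
      (\<forall>x\<in>cube n. 0 \<le> f x) \<longrightarrow>
      differentiable_DR_submodular n f G \<longrightarrow>
      (\<forall>x\<in>orthant n. f x = f (cap x)) \<longrightarrow>
      is_arg_max f (\<lambda>x. x \<in> feasible n k) xopt \<longrightarrow>
      f xopt \<le> M \<longrightarrow> M \<le> (1 + \<epsilon>) * f xopt \<longrightarrow>
      reaches n f G k \<epsilon> M N c \<longrightarrow> \<not> stalled n f G k \<epsilon> c \<longrightarrow>
      real N \<le> C * (ln (real n) * ln (1 / \<epsilon>) / \<epsilon> ^ 3)"
proof (intro exI[of _ 20] allI impI)
  fix n :: nat and f :: "vector \<Rightarrow> real" and G :: "vector \<Rightarrow> vector" and k \<epsilon> M :: real
    and N :: nat and c :: config
  assume n: "2 \<le> n" and \<epsilon>: "0 < \<epsilon>" "\<epsilon> < 1" "1 / \<epsilon> \<in> \<int>"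
    and DR: "differentiable_DR_submodular n f G"
    and run: "reaches n f G k \<epsilon> M N c" "\<not> stalled n f G k \<epsilon> c"
  obtain p where p: "1 / \<epsilon> = of_int p" using \<epsilon>(3) by (auto elim: Ints_cases)
  have "1 < 1 / \<epsilon>" using \<epsilon> by simp
  then have "2 \<le> 1 / \<epsilon>" using p by simp
  then have "\<epsilon> \<le> 1 / 2" using \<epsilon> by (simp add: field_simps)
  then interpret DR_submodular n f G \<epsilon> using DR \<epsilon> by unfold_locales
  show "real N \<le> 20 * (ln (real n) * ln (1 / \<epsilon>) / \<epsilon> ^ 3)"
    using run n \<epsilon>(3) by (rule reaches_bound)
qed

end
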